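(* Let $m$ be a positive integer and let $G$ be a simple graph on $n$ vertices with Seidel eigenvalues $\sigma_1,\sigma_2,\dots,\sigma_n$ satisfying $|\sigma_i|\geq \frac{m-1}{m}$ for all $1\le i\le n$. Then $D_m(G)$ and $D_m^*(G)$ are Seidel non-cospectral, Seidel equienergetic graphs if and only if $G$ has equal numbers of positive and negative Seidel eigenvalues.
   Context: For a simple graph $G$ with vertices $v_1,\dots,v_n$, $A(G)$ is its adjacency matrix. The Seidel matrix $S(G)=[s_{ij}]$ is the $n\times n$ matrix with $s_{ii}=0$, and for $i\neq j$, $s_{ij}=-1$ if $v_i$ is adjacent to $v_j$ and $s_{ij}=1$ otherwise; equivalently $S(G)=J-I-2A(G)$. The Seidel eigenvalues of $G$ are the eigenvalues of $S(G)$ (with multiplicity); the Seidel spectrum is their multiset. The Seidel energy is $SE(G)=\sum_{i=1}^n|\sigma_i|$. Two graphs are Seidel equienergetic if they have equal Seidel energy, and Seidel non-cospectral if their Seidel spectra differ. For a positive integer $m$: $D_m(G)$ is the simple graph with adjacency matrix $J_m\otimes A(G)$ (vertex set $\{1,\dots,m\}\times V(G)$, with $(a,u)\sim(b,v)$ iff $uv\in E(G)$), and $D_m^*(G)$ is the simple graph with adjacency matrix $J_m\otimes(A(G)+I_n)-I_{mn}$ (vertex set $\{1,\dots,m\}\times V(G)$, with distinct $(a,u),(b,v)$ adjacent iff $u=v$ or $uv\in E(G)$). Here $J_m$ is the $m\times m$ all-ones matrix and $\otimes$ is the Kronecker product.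
   Formalization: The formal statement requires m ≥ 2 and n ≥ 1: for m = 1 the graphs D_1(G) and D_1^*(G) coincide, so the equivalence fails, for example, for K_2 (Seidel eigenvalues 1 and -1); the graph with no vertices is also excluded. *)

theory Defs
  imports
    "Graph_Theory.Pair_Digraph"
    "Jordan_Normal_Form.Char_Poly"
begin

text \<open>A simple graph is a \<^locale>\<open>pair_graph\<close>: a finite, loop-free, symmetric digraph whose
  arcs are pairs of vertices, so an edge $uv$ is the pair of arcs \<open>(u, v)\<close>, \<open>(v, u)\<close>.\<close>

definition vertex_enum :: "'a pair_pre_digraph \<Rightarrow> 'a list \<Rightarrow> bool" where
  "vertex_enum G vs \<longleftrightarrow> distinct vs \<and> set vs = pverts G"

definition seidel_matrix :: "'a pair_pre_digraph \<Rightarrow> 'a list \<Rightarrow> real mat" where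
  "seidel_matrix G vs = mat (length vs) (length vs)
     (\<lambda>(i, j). if i = j then 0 else if (vs ! i, vs ! j) \<in> parcs G then -1 else 1)"

text \<open>The spectrum does not depend on the chosen enumeration of the vertices, see
  \<open>seidel_spectrum_eq\<close> below. The matrix is real symmetric, so the real roots of its
  characteristic polynomial, counted with multiplicity, are all its eigenvalues.\<close>

definition seidel_spectrum :: "'a pair_pre_digraph \<Rightarrow> real multiset" where
  "seidel_spectrum G = proots (char_poly (seidel_matrix G (SOME vs. vertex_enum G vs)))"

definition seidel_energy :: "'a pair_pre_digraph \<Rightarrow> real" where
  "seidel_energy G = (\<Sum>\<sigma>\<in>#seidel_spectrum G. \<bar>\<sigma>\<bar>)"

definition seidel_equienergetic :: "'a pair_pre_digraph \<Rightarrow> 'b pair_pre_digraph \<Rightarrow> bool" where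
  "seidel_equienergetic G H \<longleftrightarrow> seidel_energy G = seidel_energy H"

definition seidel_cospectral :: "'a pair_pre_digraph \<Rightarrow> 'b pair_pre_digraph \<Rightarrow> bool" where
  "seidel_cospectral G H \<longleftrightarrow> seidel_spectrum G = seidel_spectrum H"

definition D :: "nat \<Rightarrow> 'a pair_pre_digraph \<Rightarrow> (nat \<times> 'a) pair_pre_digraph" where
  "D m G = \<lparr> pverts = {1..m} \<times> pverts G,
     parcs = {((a, u), (b, v)) | a u b v. a \<in> {1..m} \<and> b \<in> {1..m} \<and> (u, v) \<in> parcs G} \<rparr>"

definition D_star :: "nat \<Rightarrow> 'a pair_pre_digraph \<Rightarrow> (nat \<times> 'a) pair_pre_digraph" where
  "D_star m G = \<lparr> pverts = {1..m} \<times> pverts G,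
     parcs = {((a, u), (b, v)) | a u b v. a \<in> {1..m} \<and> b \<in> {1..m} \<and>
       u \<in> pverts G \<and> v \<in> pverts G \<and> (a, u) \<noteq> (b, v) \<and> (u = v \<or> (u, v) \<in> parcs G)} \<rparr>"

lemma pair_graphI:
  assumes "finite (pverts G)" "parcs G \<subseteq> pverts G \<times> pverts G" "sym (parcs G)" "irrefl (parcs G)"
  shows "pair_graph G"
proof
  show "finite (parcs G)"
    using assms(1,2) finite_subset by blast
  show "symmetric (with_proj G)"
    using assms(3) by (auto simp: symmetric_def)
qed (use assms in \<open>auto simp: irrefl_def\<close>)

lemma pair_graph_D:
  assumes "pair_graph G"
  shows "pair_graph (D m G)"
proof -
  interpret pair_graph G by fact
  have "sym (parcs G)" using pair_sym_arcs by (simp add: symmetric_def)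
  then show ?thesis
    by (intro pair_graphI)
      (auto simp: D_def sym_def irrefl_def pair_finite_verts dest: in_arcsD1 in_arcsD2 no_loops')
qed

lemma pair_graph_D_star:
  assumes "pair_graph G"
  shows "pair_graph (D_star m G)"
proof -
  interpret pair_graph G by fact
  have "sym (parcs G)" using pair_sym_arcs by (simp add: symmetric_def)
  then show ?thesis
    by (intro pair_graphI)
      (auto simp: D_star_def sym_def irrefl_def pair_finite_verts)
qed

text \<open>For \<open>m = 1\<close> the two graphs coincide, so they are never non-cospectral, whatever the signs of the
  Seidel eigenvalues of \<open>G\<close> (two vertices suffice for eigenvalues \<open>1\<close>, \<open>-1\<close>). Hence the
  equivalence can only hold for \<open>m \<ge> 2\<close>.\<close>

lemma D_1_eq_D_star_1:
  assumes "pair_graph G"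
  shows "D 1 G = D_star 1 G"
proof -
  interpret pair_graph G by fact
  show ?thesis
    by (auto simp: D_def D_star_def dest: in_arcsD1 in_arcsD2 no_loops')
qed

lemma det_permute_rows_cols:
  fixes B :: "'a :: comm_ring_1 mat"
  assumes B: "B \<in> carrier_mat n n" and p: "p permutes {0..<n}"
  shows "det (mat n n (\<lambda>(i, j). B $$ (p i, p j))) = det B"
proof -
  have lt: "p i < n" if "i < n" for i
    using permutes_in_image[OF p, of i] that by simp
  define C where "C = mat n n (\<lambda>(i, j). B $$ (p i, j))"
  have C: "C \<in> carrier_mat n n" by (simp add: C_def)
  have "mat n n (\<lambda>(i, j). B $$ (p i, p j)) =
      transpose_mat (mat n n (\<lambda>(i, j). transpose_mat C $$ (p i, j)))"
    by (rule eq_matI) (auto simp: C_def lt)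
  then have "det (mat n n (\<lambda>(i, j). B $$ (p i, p j))) =
      det (mat n n (\<lambda>(i, j). transpose_mat C $$ (p i, j)))"
    by (simp add: det_transpose[of _ n])
  also have "\<dots> = signof p * det C"
    using C by (simp add: det_permute_rows[OF _ p] det_transpose)
  also have "\<dots> = signof p * (signof p * det B)"
    by (simp add: C_def det_permute_rows[OF B p])
  also have "\<dots> = det B"
    by (simp add: sign_def)
  finally show ?thesis .
qed

lemma char_poly_seidel_matrix_enum:
  assumes vs: "vertex_enum G vs" and ws: "vertex_enum G ws"
  shows "char_poly (seidel_matrix G ws) = char_poly (seidel_matrix G vs)"
proof -
  define n where "n = length vs"
  have lvs: "length vs = n" and lws: "length ws = n"
    using vs ws by (auto simp: vertex_enum_def n_def simp flip: distinct_card)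
  have bij: "bij_betw ((!) vs) {0..<n} (pverts G)" "bij_betw ((!) ws) {0..<n} (pverts G)"
    using vs ws lvs lws
    by (auto simp: vertex_enum_def atLeast0LessThan intro!: bij_betw_nth)
  define q where "q = inv_into {0..<n} ((!) vs) \<circ> (!) ws"
  define p where "p = (\<lambda>i. if i \<in> {0..<n} then q i else i)"
  have "bij_betw q {0..<n} {0..<n}"
    unfolding q_def using bij by (intro bij_betw_trans[OF bij(2)] bij_betw_inv_into)
  then have "bij_betw p {0..<n} {0..<n}"
    by (subst bij_betw_cong[of _ _ q]) (auto simp: p_def)
  then have p: "p permutes {0..<n}"
    by (rule bij_imp_permutes) (auto simp: p_def)
  have lt: "p i < n" if "i < n" for i
    using permutes_in_image[OF p, of i] that by simp
  have eq: "p i = p j \<longleftrightarrow> i = j" for i j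
    using permutes_inj[OF p] by (auto dest: injD)
  have nth: "vs ! p i = ws ! i" if "i < n" for i
    using bij that by (auto simp: p_def q_def intro!: bij_betw_inv_into_right dest: bij_betwE)
  define B where "B = char_poly_matrix (seidel_matrix G vs)"
  have B: "B \<in> carrier_mat n n"
    by (simp add: B_def seidel_matrix_def lvs char_poly_matrix_def)
  have "char_poly_matrix (seidel_matrix G ws) = mat n n (\<lambda>(i, j). B $$ (p i, p j))"
    by (rule eq_matI)
      (auto simp: B_def char_poly_matrix_def seidel_matrix_def lvs lws lt eq nth)
  then show ?thesis
    using det_permute_rows_cols[OF B p] by (simp add: char_poly_def B_def)
qed

lemma seidel_spectrum_eq:
  assumes "vertex_enum G vs"
  shows "seidel_spectrum G = proots (char_poly (seidel_matrix G vs))"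
  unfolding seidel_spectrum_def
  using char_poly_seidel_matrix_enum[OF assms someI[of "vertex_enum G", OF assms]] by simp

end

theory Submission
  imports Defs
begin

text \<open>Since \<open>AB\<close> and \<open>BA\<close> have the same nonzero eigenvalues, \<open>D\<^sub>m(G)\<close> has the Seidel eigenvalues
  \<open>m \<sigma> + (m - 1)\<close> and \<open>-1\<close> with multiplicity \<open>n (m - 1)\<close>, while \<open>D\<^sub>m\<^sup>*(G)\<close> has \<open>m \<sigma> - (m - 1)\<close>
  and \<open>1\<close> with multiplicity \<open>n (m - 1)\<close>. As \<open>m \<bar>\<sigma>\<bar> \<ge> m - 1\<close>, the two energies differ by
  \<open>2 (m - 1) (p - q)\<close>, where \<open>p\<close> and \<open>q\<close> count the positive and the negative \<open>\<sigma>\<close>. If \<open>p = q\<close>, the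
  spectra differ because \<open>D\<^sub>m(G)\<close> has only \<open>p \<le> n / 2\<close> positive Seidel eigenvalues and \<open>D\<^sub>m\<^sup>*(G)\<close>
  at least \<open>n (m - 1) \<ge> n\<close>.\<close>

section \<open>Affine changes of a matrix and of its eigenvalues\<close>

lemma proots_pcompose_linear:
  fixes p :: "'a :: field poly"
  assumes "a \<noteq> 0"
  shows "proots (pcompose p [:- b / a, 1 / a:]) = image_mset (\<lambda>x. a * x + b) (proots p)"
proof (induction p rule: poly_root_order_induct)
  case 0
  then show ?case by simp
next
  case (no_roots p)
  have "poly (pcompose p [:- b / a, 1 / a:]) x \<noteq> 0" for x
    using no_roots by (simp add: poly_pcompose)
  then have "proots (pcompose p [:- b / a, 1 / a:]) = {#}"
    by (intro multiset_eqI) (metis count_empty count_proots order_0I proots_0)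
  moreover have "proots p = {#}"
    using no_roots by (intro multiset_eqI) (metis count_empty count_proots order_0I proots_0)
  ultimately show ?case by simp
next
  case (root p x n)
  define q where "q = [:- b / a, 1 / a:]"
  \<comment> \<open>Since \<open>q\<close> is the inverse of the map y -> a y + b, a root x moves to
    a x + b; the scalar 1 / a does not affect roots.\<close>
  have lin: "pcompose [:- x, 1:] q = Polynomial.smult (1 / a) [:- (a * x + b), 1:]"
    using assms by (simp add: q_def pcompose_pCons field_simps)
  then have lin_roots: "proots (pcompose [:- x, 1:] q) = {#a * x + b#}"
    using assms proots_linear_factor[of "- (a * x + b)"]
    by (metis minus_minus proots_smult divide_eq_0_iff zero_neq_one)
  have lin_nz: "pcompose [:- x, 1:] q \<noteq> 0"
    using assms unfolding lin by simp
  have "p \<noteq> 0" using root by auto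
  \<comment> \<open>Roots of a product add up only for nonzero factors, as \<open>proots 0\<close>
    is empty by convention.\<close>
  then have "pcompose p q \<noteq> 0"
    using assms pcompose_eq_0_iff[of q p] by (simp add: q_def)
  then have "proots (pcompose ([:- x, 1:] ^ n * p) q) =
      replicate_mset n (a * x + b) + proots (pcompose p q)"
    using lin_nz
    by (simp only: pcompose_mult pcompose_hom.hom_power proots_mult proots_power lin_roots
        power_not_zero simp_thms repeat_mset_replicate_mset)
  also have "\<dots> = image_mset (\<lambda>x. a * x + b) (proots ([:- x, 1:] ^ n * p))"
    using root \<open>p \<noteq> 0\<close> by (simp add: proots_mult proots_power q_def)
  finally show ?case by (simp only: q_def)
qed

text \<open>Pointwise, k I - (a A + b I) = a ((k - b) / a I - A), and the determinant pulls out a ^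
  n. Over an infinite field, agreement at all points k gives equality of polynomials.\<close>

lemma char_poly_affine:
  fixes A :: "'a :: field_char_0 mat"
  assumes A: "A \<in> carrier_mat n n" and a: "a \<noteq> 0"
  shows "char_poly (a \<cdot>\<^sub>m A + b \<cdot>\<^sub>m 1\<^sub>m n) =
    Polynomial.smult (a ^ n) (pcompose (char_poly A) [:- b / a, 1 / a:])"
proof -
  have "poly (char_poly (a \<cdot>\<^sub>m A + b \<cdot>\<^sub>m 1\<^sub>m n)) k =
      poly (Polynomial.smult (a ^ n) (pcompose (char_poly A) [:- b / a, 1 / a:])) k" for k
  proof -
    have M: "a \<cdot>\<^sub>m A + b \<cdot>\<^sub>m 1\<^sub>m n \<in> carrier_mat n n" using A by simp
    have "- char_matrix (a \<cdot>\<^sub>m A + b \<cdot>\<^sub>m 1\<^sub>m n) k = a \<cdot>\<^sub>m (- char_matrix A (k / a - b / a))"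
      by (rule eq_matI) (use A a in \<open>auto simp: char_matrix_def field_simps\<close>)
    then show ?thesis
      using A by (simp add: char_poly_matrix[OF M] char_poly_matrix[OF A] poly_pcompose
          det_smult char_matrix_def)
  qed
  then show ?thesis by (simp add: poly_eq_poly_eq_iff[symmetric] fun_eq_iff)
qed

lemma proots_char_poly_affine:
  fixes A :: "'a :: field_char_0 mat"
  assumes "A \<in> carrier_mat n n" "a \<noteq> 0"
  shows "proots (char_poly (a \<cdot>\<^sub>m A + b \<cdot>\<^sub>m 1\<^sub>m n)) =
    image_mset (\<lambda>x. a * x + b) (proots (char_poly A))"
  using assms proots_pcompose_linear[OF assms(2), of "char_poly A" b] by (simp add: char_poly_affine)

section \<open>Characteristic polynomials of A B and B A, and of Kronecker products with J\<close>

lemma char_poly_four_block_lower_triangular: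
  fixes A :: "'a :: idom mat"
  assumes "A \<in> carrier_mat n n" "C \<in> carrier_mat m n" "B \<in> carrier_mat m m"
  shows "char_poly (four_block_mat A (0\<^sub>m n m) C B) = char_poly A * char_poly B"
proof -
  have "char_poly_matrix (four_block_mat A (0\<^sub>m n m) C B) =
      four_block_mat (char_poly_matrix A) (0\<^sub>m n m) (map_mat (\<lambda>a. [:- a:]) C) (char_poly_matrix B)"
    by (rule eq_matI) (use assms in \<open>auto simp: char_poly_matrix_def\<close>)
  then show ?thesis
    using assms by (simp add: char_poly_def det_four_block_mat_upper_right_zero[OF _ refl])
qed

lemma char_poly_zero_mat: "char_poly (0\<^sub>m n n :: 'a :: comm_ring_1 mat) = [:0, 1:] ^ n"
proof -
  have "char_poly_matrix (0\<^sub>m n n :: 'a mat) = [:0, 1:] \<cdot>\<^sub>m 1\<^sub>m n"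
    by (rule eq_matI) (auto simp: char_poly_matrix_def)
  then show ?thesis by (simp add: char_poly_def det_smult)
qed

text \<open>The block triangular matrices \<open>X\<close> and \<open>Y\<close>, with diagonal
  blocks A B, 0 and 0, B A, are conjugate by the unipotent \<open>P\<close>, whose inverse is
  \<open>Q\<close>. The zero blocks supply the powers of the indeterminate.\<close>

lemma char_poly_mult_commute:
  fixes A :: "'a :: idom mat"
  assumes A: "A \<in> carrier_mat k n" and B: "B \<in> carrier_mat n k"
  shows "[:0, 1:] ^ n * char_poly (A * B) = [:0, 1:] ^ k * char_poly (B * A)"
proof -
  define P where "P = four_block_mat (1\<^sub>m k) A (0\<^sub>m n k) (1\<^sub>m n)"
  define Q where "Q = four_block_mat (1\<^sub>m k) (- A) (0\<^sub>m n k) (1\<^sub>m n)"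
  define X where "X = four_block_mat (A * B) (0\<^sub>m k n) B (0\<^sub>m n n)"
  define Y where "Y = four_block_mat (0\<^sub>m k k) (0\<^sub>m k n) B (B * A)"
  have carr: "{X, Y, P, Q} \<subseteq> carrier_mat (k + n) (k + n)"
    using A B by (auto simp: P_def Q_def X_def Y_def)
  have AB: "A * B \<in> carrier_mat k k" "B * A \<in> carrier_mat n n" using A B by auto
  have inv: "A + - A = 0\<^sub>m k n" "- A + A = 0\<^sub>m k n" "- 0\<^sub>m n n = (0\<^sub>m n n :: 'a mat)"
    using A by (auto intro!: eq_matI)
  have PQ: "P * Q = 1\<^sub>m (k + n)" "Q * P = 1\<^sub>m (k + n)"
    unfolding P_def Q_def using A
    by (auto simp: mult_four_block_mat[of _ k k _ n _ n _ _ k _ n] inv)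
  have PY: "P * Y = four_block_mat (A * B) (A * (B * A)) B (B * A)"
    unfolding P_def Y_def using A B AB
    by (subst mult_four_block_mat[of _ k k _ n _ n _ _ k _ n]) auto
  have "P * Y * Q = X"
    unfolding PY X_def Q_def using A B AB
    by (subst mult_four_block_mat[of _ k k _ n _ n _ _ k _ n])
      (auto simp: assoc_mult_mat[OF A B A])
  then have "similar_mat X Y"
    using carr PQ by (intro similar_matI[of X Y P Q]) simp_all
  then have "char_poly X = char_poly Y" by (rule char_poly_similar)
  then show ?thesis
    unfolding X_def Y_def using A B AB
    by (simp add: char_poly_four_block_lower_triangular char_poly_zero_mat mult.commute)
qed

text \<open>The matrix \<open>J\<^sub>m \<otimes> B\<close> is \<open>E B E\<^sup>T\<close>, where \<open>E\<close> consists of \<open>m\<close> stacked identity matrices and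
  hence \<open>E\<^sup>T E = m I\<close>.\<close>

lemma proots_char_poly_blow_up:
  fixes B :: "'a :: field_char_0 mat"
  assumes B: "B \<in> carrier_mat n n" and m: "m > 0"
  defines "K \<equiv> mat (m * n) (m * n) (\<lambda>(i, j). B $$ (i mod n, j mod n))"
  shows "proots (char_poly K) =
    replicate_mset ((m - 1) * n) 0 + image_mset (\<lambda>x. of_nat m * x) (proots (char_poly B))"
proof -
  define E :: "'a mat" where "E = mat (m * n) n (\<lambda>(i, j). if i mod n = j then 1 else 0)"
  \<comment> \<open>This factorization gives E F = K of size m n, while F E collapses to m B of size
    n.\<close>
  define F where "F = B * transpose_mat E"
  have E: "E \<in> carrier_mat (m * n) n" and F: "F \<in> carrier_mat n (m * n)"
    using B by (auto simp: E_def F_def)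
  have F_index: "F $$ (i, j) = B $$ (i, j mod n)" if "i < n" "j < m * n" for i j
  proof -
    have "n > 0" using that by simp
    have "F $$ (i, j) = (\<Sum>l<n. B $$ (i, l) * (if j mod n = l then 1 else 0))"
      using that B by (simp add: F_def E_def scalar_prod_def lessThan_atLeast0)
    then show ?thesis using \<open>n > 0\<close> by (simp add: if_distrib cong: if_cong)
  qed
  have EF: "E * F = K"
  proof (rule eq_matI)
    fix i j assume "i < dim_row K" "j < dim_col K"
    then have ij: "i < m * n" "j < m * n" by (auto simp: K_def)
    then have "n > 0" by (cases n) auto
    have "(E * F) $$ (i, j) = (\<Sum>l<n. (if i mod n = l then 1 else 0) * F $$ (l, j))"
      using ij F by (simp add: E_def scalar_prod_def lessThan_atLeast0)
    also have "\<dots> = F $$ (i mod n, j)"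
      using \<open>n > 0\<close> by (simp add: if_distrib[of "\<lambda>x. x * _"] cong: if_cong)
    finally show "(E * F) $$ (i, j) = K $$ (i, j)"
      using ij \<open>n > 0\<close> by (simp add: F_index K_def)
  qed (use E F in \<open>auto simp: K_def\<close>)
  have shift: "sum f {a * n..<a * n + n} = (\<Sum>c<n. f (c + a * n))" for f :: "nat \<Rightarrow> 'a" and a
    using sum.shift_bounds_nat_ivl[of f 0 "a * n" n] by (simp add: lessThan_atLeast0 add.commute)
  \<comment> \<open>The zero summand matches the form of \<open>proots_char_poly_affine\<close> with
    b = 0.\<close>
  have FE: "F * E = of_nat m \<cdot>\<^sub>m B + 0 \<cdot>\<^sub>m 1\<^sub>m n"
  proof (rule eq_matI)
    fix i j assume "i < dim_row (of_nat m \<cdot>\<^sub>m B + 0 \<cdot>\<^sub>m 1\<^sub>m n)" "j < dim_col (of_nat m \<cdot>\<^sub>m B + 0 \<cdot>\<^sub>m 1\<^sub>m n)"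
    then have ij: "i < n" "j < n" using B by auto
    have "(F * E) $$ (i, j) = (\<Sum>l<m * n. F $$ (i, l) * (if l mod n = j then 1 else 0))"
      using ij F by (simp add: E_def scalar_prod_def lessThan_atLeast0)
    also have "\<dots> = (\<Sum>l<m * n. B $$ (i, l mod n) * (if l mod n = j then 1 else 0))"
      using ij by (intro sum.cong) (auto simp: F_index)
    \<comment> \<open>Write l = c + a n, with block a and position c; each of the m blocks
      contributes the entry (i, j) of B once.\<close>
    also have "\<dots> = (\<Sum>a<m. \<Sum>c<n. B $$ (i, (c + a * n) mod n) * (if (c + a * n) mod n = j then 1 else 0))"
      by (simp add: sum.nat_group[symmetric] shift)
    also have "\<dots> = (\<Sum>a<m. \<Sum>c<n. if c = j then B $$ (i, c) else 0)"
      by (intro sum.cong) auto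
    also have "\<dots> = of_nat m * B $$ (i, j)" using ij by simp
    finally show "(F * E) $$ (i, j) = (of_nat m \<cdot>\<^sub>m B + 0 \<cdot>\<^sub>m 1\<^sub>m n) $$ (i, j)"
      using ij B by simp
  qed (use E F B in auto)
  have split: "m * n = n + (m - 1) * n" using m by (cases m) auto
  have "[:0, 1:] ^ n * char_poly K = [:0, 1:] ^ (m * n) * char_poly (F * E)"
    using char_poly_mult_commute[OF E F] by (simp add: EF)
  \<comment> \<open>Cancelling the n-th power of the indeterminate leaves (m - 1) n extra zero
    roots.\<close>
  then have K: "char_poly K = [:0, 1:] ^ ((m - 1) * n) * char_poly (F * E)"
    unfolding split power_add by (simp add: mult.assoc)
  have "char_poly (F * E) \<noteq> 0"
    using degree_monic_char_poly[of "F * E" n] E F by force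
  then show ?thesis
    using m B proots_char_poly_affine[OF B, of "of_nat m" 0]
    by (simp add: K FE proots_mult proots_power repeat_mset_replicate_mset del: mult_pCons_left)
qed

section \<open>Seidel spectra of the two blow-ups\<close>

lemma seidel_matrix_carrier: "seidel_matrix G vs \<in> carrier_mat (length vs) (length vs)"
  by (simp add: seidel_matrix_def)

text \<open>Listing the vertices copy by copy puts J on the left of the Kronecker product, so the
  vertex depends only on the index mod n. The + 1 is there because copies are numbered from
  1.\<close>

definition blow_up_enum :: "nat \<Rightarrow> 'a list \<Rightarrow> (nat \<times> 'a) list" where
  "blow_up_enum m vs = map (\<lambda>i. (i div length vs + 1, vs ! (i mod length vs))) [0..<m * length vs]"

lemma vertex_enum_blow_up_enum:
  assumes "vertex_enum G vs" "pverts H = {1..m} \<times> pverts G"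
  shows "vertex_enum H (blow_up_enum m vs)"
proof -
  define n where "n = length vs"
  have vs: "distinct vs" "set vs = pverts G" using assms by (auto simp: vertex_enum_def)
  have "inj_on (\<lambda>i. (i div n + 1, vs ! (i mod n))) {0..<m * n}"
  proof (rule inj_onI)
    fix i j assume ij: "i \<in> {0..<m * n}" "j \<in> {0..<m * n}"
      and eq: "(i div n + 1, vs ! (i mod n)) = (j div n + 1, vs ! (j mod n))"
    then have "n > 0" by (cases n) auto
    then have "i mod n = j mod n"
      using eq vs(1) by (simp add: n_def nth_eq_iff_index_eq)
    then show "i = j" using eq by (metis Pair_inject add_right_cancel div_mult_mod_eq)
  qed
  moreover have "(\<lambda>i. (i div n + 1, vs ! (i mod n))) ` {0..<m * n} = {1..m} \<times> set vs"
  proof safe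
    fix i assume "i \<in> {0..<m * n}"
    then have "i < m * n" "n > 0" by (cases n; simp)+
    then show "i div n + 1 \<in> {1..m}" "vs ! (i mod n) \<in> set vs"
      by (auto simp: n_def Suc_le_eq less_mult_imp_div_less)
  next
    fix a v assume a: "a \<in> {1..m}" and "v \<in> set vs"
    then obtain j where j: "j < n" "v = vs ! j" by (auto simp: in_set_conv_nth n_def)
    obtain b where b: "a = Suc b" "b < m" using a by (cases a) auto
    have "b * n + j < Suc b * n" using j by simp
    also have "\<dots> \<le> m * n" using b by (intro mult_right_mono) auto
    finally show "(a, v) \<in> (\<lambda>i. (i div n + 1, vs ! (i mod n))) ` {0..<m * n}"
      using j b by (intro image_eqI[of _ _ "b * n + j"]) auto
  qed
  ultimately show ?thesis
    using assms vs by (auto simp: vertex_enum_def blow_up_enum_def distinct_map n_def)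
qed

text \<open>In both blow-ups the Seidel matrix is \<open>J\<^sub>m \<otimes> (S + s I) - s I\<close>, where \<open>s\<close> is the entry
  for two distinct copies of one vertex.\<close>

lemma seidel_spectrum_blow_up:
  fixes s :: real
  assumes G: "pair_graph G" and m: "m > 0" and s: "s = 1 \<or> s = - 1"
    and H: "pverts H = {1..m} \<times> pverts G"
    and adj: "\<And>a b u v. a \<in> {1..m} \<Longrightarrow> b \<in> {1..m} \<Longrightarrow> u \<in> pverts G \<Longrightarrow> v \<in> pverts G \<Longrightarrow>
      (a, u) \<noteq> (b, v) \<Longrightarrow>
      ((a, u), (b, v)) \<in> parcs H \<longleftrightarrow> (if u = v then s = - 1 else (u, v) \<in> parcs G)"
  shows "seidel_spectrum H = replicate_mset ((m - 1) * card (pverts G)) (- s) +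
    image_mset (\<lambda>\<sigma>. real m * \<sigma> + s * (real m - 1)) (seidel_spectrum G)"
proof -
  interpret pair_graph G by fact
  obtain vs where vs: "vertex_enum G vs"
    using finite_distinct_list[OF pair_finite_verts] by (auto simp: vertex_enum_def)
  define n where "n = length vs"
  define S where "S = seidel_matrix G vs"
  define B where "B = 1 \<cdot>\<^sub>m S + s \<cdot>\<^sub>m 1\<^sub>m n"
  define K where "K = mat (m * n) (m * n) (\<lambda>(i, j). B $$ (i mod n, j mod n))"
  have S: "S \<in> carrier_mat n n" by (simp add: S_def n_def seidel_matrix_carrier)
  have K: "K \<in> carrier_mat (m * n) (m * n)" by (simp add: K_def)
  have card: "card (pverts G) = n"
    using vs distinct_card[of vs] by (simp add: vertex_enum_def n_def)
  have enum: "vertex_enum H (blow_up_enum m vs)"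
    using vs H by (rule vertex_enum_blow_up_enum)
  have "seidel_matrix H (blow_up_enum m vs) = 1 \<cdot>\<^sub>m K + (- s) \<cdot>\<^sub>m 1\<^sub>m (m * n)"
  proof (rule eq_matI)
    fix i j assume "i < dim_row (1 \<cdot>\<^sub>m K + (- s) \<cdot>\<^sub>m 1\<^sub>m (m * n))"
      "j < dim_col (1 \<cdot>\<^sub>m K + (- s) \<cdot>\<^sub>m 1\<^sub>m (m * n))"
    then have ij: "i < m * n" "j < m * n" using K by auto
    then have n: "n > 0" by (cases n) auto
    define a u where "a = i div n + 1" and "u = vs ! (i mod n)"
    define b v where "b = j div n + 1" and "v = vs ! (j mod n)"
    have ab: "a \<in> {1..m}" "b \<in> {1..m}"
      using ij by (simp_all add: a_def b_def Suc_le_eq less_mult_imp_div_less)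
    have uv: "u \<in> pverts G" "v \<in> pverts G"
      using vs n nth_mem[of "i mod n" vs] nth_mem[of "j mod n" vs]
      by (simp_all add: vertex_enum_def n_def u_def v_def)
    have u_eq_v: "u = v \<longleftrightarrow> i mod n = j mod n"
      using vs n by (simp add: vertex_enum_def n_def u_def v_def nth_eq_iff_index_eq)
    have distinct: "(a, u) \<noteq> (b, v)" if "i \<noteq> j"
      using that u_eq_v by (metis Pair_inject a_def add_right_cancel b_def div_mult_mod_eq)
    have "seidel_matrix H (blow_up_enum m vs) $$ (i, j) =
        (if i = j then 0 else if ((a, u), (b, v)) \<in> parcs H then - 1 else 1)"
      using ij by (simp add: seidel_matrix_def blow_up_enum_def a_def b_def u_def v_def flip: n_def)
    \<comment> \<open>Two distinct copies of one vertex are adjacent exactly if s = -1, so their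
      entry is s in either case.\<close>
    also have "\<dots> = (if i = j then 0 else if u = v then s else if (u, v) \<in> parcs G then - 1 else 1)"
      using adj[OF ab uv] distinct s by auto
    also have "\<dots> = (1 \<cdot>\<^sub>m K + (- s) \<cdot>\<^sub>m 1\<^sub>m (m * n)) $$ (i, j)"
      using ij n S u_eq_v
      by (simp add: K_def B_def S_def seidel_matrix_def u_def v_def flip: n_def)
    finally show "seidel_matrix H (blow_up_enum m vs) $$ (i, j) =
        (1 \<cdot>\<^sub>m K + (- s) \<cdot>\<^sub>m 1\<^sub>m (m * n)) $$ (i, j)" .
  qed (auto simp: seidel_matrix_def blow_up_enum_def K_def n_def)
  then have "seidel_spectrum H = image_mset (\<lambda>x. x - s) (proots (char_poly K))"
    using proots_char_poly_affine[OF K, of 1 "- s"] by (simp add: seidel_spectrum_eq[OF enum])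
  also have "proots (char_poly K) = replicate_mset ((m - 1) * n) 0 +
      image_mset (\<lambda>x. real m * x) (proots (char_poly B))"
    unfolding K_def using S m by (intro proots_char_poly_blow_up) (auto simp: B_def)
  also have "proots (char_poly B) = image_mset (\<lambda>x. x + s) (seidel_spectrum G)"
    using proots_char_poly_affine[OF S, of 1 s] by (simp add: B_def S_def seidel_spectrum_eq[OF vs])
  \<comment> \<open>The extra zeros shift to -s, and m (x + s) - s = m x + s (m - 1).\<close>
  finally show ?thesis
    by (simp add: card image_mset.compositionality o_def algebra_simps)
qed

lemma seidel_spectrum_D:
  assumes "pair_graph G" "m > 0"
  shows "seidel_spectrum (D m G) = replicate_mset ((m - 1) * card (pverts G)) (- 1) +
    image_mset (\<lambda>\<sigma>. real m * \<sigma> + (real m - 1)) (seidel_spectrum G)"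
proof -
  interpret pair_graph G by fact
  have "seidel_spectrum (D m G) = replicate_mset ((m - 1) * card (pverts G)) (- 1) +
      image_mset (\<lambda>\<sigma>. real m * \<sigma> + 1 * (real m - 1)) (seidel_spectrum G)"
    \<comment> \<open>Here s = 1: copies of one vertex are nonadjacent because G has no
      loops.\<close>
    using assms no_loops' by (intro seidel_spectrum_blow_up) (auto simp: D_def)
  then show ?thesis by simp
qed

lemma seidel_spectrum_D_star:
  assumes "pair_graph G" "m > 0"
  shows "seidel_spectrum (D_star m G) = replicate_mset ((m - 1) * card (pverts G)) 1 +
    image_mset (\<lambda>\<sigma>. real m * \<sigma> - (real m - 1)) (seidel_spectrum G)"
proof -
  have "seidel_spectrum (D_star m G) = replicate_mset ((m - 1) * card (pverts G)) (- (- 1)) +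
      image_mset (\<lambda>\<sigma>. real m * \<sigma> + (- 1) * (real m - 1)) (seidel_spectrum G)"
    using assms by (intro seidel_spectrum_blow_up) (auto simp: D_star_def)
  then show ?thesis by (simp add: algebra_simps)
qed

section \<open>Counting eigenvalues and comparing energies\<close>

lemma filter_mset_replicate_mset:
  "filter_mset P (replicate_mset n x) = (if P x then replicate_mset n x else {#})"
  by (induction n) auto

lemma size_seidel_spectrum_le:
  assumes "pair_graph G"
  shows "size (seidel_spectrum G) \<le> card (pverts G)"
proof -
  interpret pair_graph G by fact
  obtain vs where vs: "vertex_enum G vs"
    using finite_distinct_list[OF pair_finite_verts] by (auto simp: vertex_enum_def)
  then have "card (pverts G) = length vs"
    using distinct_card[of vs] by (simp add: vertex_enum_def)
  then show ?thesis
    using size_proots_le[of "char_poly (seidel_matrix G vs)"]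
      degree_monic_char_poly[OF seidel_matrix_carrier[of G vs]]
    by (simp add: seidel_spectrum_eq[OF vs])
qed

text \<open>As k |x| is at least c > 0, no x is zero and neither shift by c carries k x past zero.
  Each x therefore contributes 2 c or -2 c according to its sign.\<close>

lemma sum_mset_abs_shift_diff:
  fixes M :: "real multiset"
  assumes "\<forall>x\<in>#M. \<bar>x\<bar> \<ge> c / k" "k > 0" "c > 0"
  shows "(\<Sum>x\<in>#M. \<bar>k * x + c\<bar>) - (\<Sum>x\<in>#M. \<bar>k * x - c\<bar>) =
    2 * c * (real (size {#x \<in># M. x > 0#}) - real (size {#x \<in># M. x < 0#}))"
  using assms(1)
proof (induction M)
  case (add x M)
  have "\<bar>x\<bar> * k \<ge> c" using add.prems assms by (simp add: pos_divide_le_eq)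
  then have "x \<noteq> 0" "x > 0 \<Longrightarrow> k * x \<ge> c" "x < 0 \<Longrightarrow> k * x \<le> - c"
    using assms by (auto simp: mult.commute)
  then have "\<bar>k * x + c\<bar> - \<bar>k * x - c\<bar> = (if x > 0 then 2 * c else - 2 * c)" "x \<noteq> 0"
    using assms by (cases "x > 0"; simp)+
  then show ?case using add by (auto simp: algebra_simps)
qed simp

theorem theorem1:
  fixes m :: nat and G :: "'a pair_pre_digraph"
  assumes "m \<ge> 2"
    and "pair_graph G" and "pverts G \<noteq> {}"
    and "\<forall>\<sigma>\<in>#seidel_spectrum G. \<bar>\<sigma>\<bar> \<ge> (real m - 1) / real m"
  shows "(\<not> seidel_cospectral (D m G) (D_star m G) \<and> seidel_equienergetic (D m G) (D_star m G))
    \<longleftrightarrow> size {#\<sigma> \<in># seidel_spectrum G. \<sigma> > 0#} = size {#\<sigma> \<in># seidel_spectrum G. \<sigma> < 0#}"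
proof -
  interpret pair_graph G by fact
  define M where "M = seidel_spectrum G"
  define p where "p = size {#\<sigma> \<in># M. \<sigma> > 0#}"
  define q where "q = size {#\<sigma> \<in># M. \<sigma> < 0#}"
  define n where "n = card (pverts G)"
  have "n > 0" using assms(3) pair_finite_verts by (simp add: n_def card_gt_0_iff)
  have m: "m > 0" using assms(1) by simp
  note spec = seidel_spectrum_D[OF assms(2) m, folded M_def n_def]
    seidel_spectrum_D_star[OF assms(2) m, folded M_def n_def]
  have "seidel_energy (D m G) - seidel_energy (D_star m G) = 2 * (real m - 1) * (real p - real q)"
    using sum_mset_abs_shift_diff[of M "real m - 1" "real m"] assms(1,4)
    by (simp add: seidel_energy_def spec image_mset.compositionality o_def M_def p_def q_def)
  \<comment> \<open>The factor 2 (m - 1) is nonzero because m is at least 2.\<close>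
  then have energy: "seidel_equienergetic (D m G) (D_star m G) \<longleftrightarrow> p = q"
    using assms(1) by (auto simp: seidel_equienergetic_def)
  have "\<not> seidel_cospectral (D m G) (D_star m G)" if "p = q"
  proof
    assume "seidel_cospectral (D m G) (D_star m G)"
    then have eq: "size {#x \<in># seidel_spectrum (D m G). x > 0#} =
        size {#x \<in># seidel_spectrum (D_star m G). x > 0#}"
      by (simp add: seidel_cospectral_def)
    \<comment> \<open>A nonpositive eigenvalue is at most -(m - 1) / m, so its shifted value cannot
      exceed 0.\<close>
    have pos: "\<sigma> > 0" if "\<sigma> \<in># M" "real m * \<sigma> + (real m - 1) > 0" for \<sigma>
    proof (rule ccontr)
      assume "\<not> \<sigma> > 0"
      then have "- \<sigma> \<ge> (real m - 1) / real m" using assms(4) that by (force simp: M_def)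
      then have "- \<sigma> * real m \<ge> real m - 1" using m by (simp add: pos_divide_le_eq)
      then show False using that by (simp add: mult.commute)
    qed
    \<comment> \<open>The eigenvalue 1 of \<open>D_star m G\<close> alone already accounts for n
      positive ones; in \<open>D m G\<close> the copies of -1 count for nothing.\<close>
    have "n \<le> (m - 1) * n" using assms(1) by (cases m) auto
    also have "\<dots> \<le> size {#x \<in># seidel_spectrum (D_star m G). x > 0#}"
      by (simp add: spec filter_mset_replicate_mset)
    also have "\<dots> = size {#\<sigma> \<in># M. real m * \<sigma> + (real m - 1) > 0#}"
      unfolding eq[symmetric] by (simp add: spec filter_mset_image_mset filter_mset_replicate_mset)
    also have "\<dots> \<le> p"
      unfolding p_def using pos
      by (intro size_mset_mono) (auto simp: subseteq_mset_def not_in_iff[symmetric])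
    finally have "n \<le> p" .
    have "p + q = size {#\<sigma> \<in># M. \<sigma> > 0 \<or> \<sigma> < 0#}"
      unfolding p_def q_def size_union[symmetric]
      by (intro arg_cong[of _ _ size] multiset_eqI) auto
    also have "\<dots> \<le> size M" by (simp add: size_filter_mset_lesseq)
    also have "\<dots> \<le> n" using size_seidel_spectrum_le[OF assms(2)] by (simp add: M_def n_def)
    \<comment> \<open>With p = q, the bounds n <= p and p + q <= n would give 2 n <= n.\<close>
    finally show False using that \<open>n \<le> p\<close> \<open>n > 0\<close> by simp
  qed
  with energy show ?thesis by (auto simp: p_def q_def M_def)
qed

end
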